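(* Let $m\ge 1$ users share a resource with availability process $c(t)\ge 0$ of long-term average $\bar c>0$, with consumption processes $F_i(t)$ of long-term averages $f_i$, and increasing concave dissatisfaction functions $V_i:[0,\infty)\to[0,\infty)$ with $V_i(0)=0$, as described in the context. (a) (Known mean consumptions.) When $f_1,\dots,f_m$ are known, it is impossible for an allowable policy $\{S_i(t)\}$ to achieve a lower long-term average dissatisfaction $\frac1m\sum_{i=1}^m V_i(\bar\kappa_i)$ than $$\bar V=\min\Big\{\tfrac1m\sum_{i=1}^m V_i(\max(f_i-s_i,0)) \;:\; s_i\ge 0\ \forall i,\ \sum_{i=1}^m s_i\le \bar c\Big\}.$$ (b) (Unknown mean consumptions.) When $f_1,\dots,f_m$ are unknown, with $f_i$ having prior distribution $p_i$, it is impossible for an allowable policy to achieve a lower expected long-term average dissatisfaction $\frac1m\sum_{i=1}^m \mathbb E_{f_i\sim p_i}[V_i(\bar\kappa_i)]$ than $$\tilde V=\min\Big\{\tfrac1m\sum_{i=1}^m \mathbb E_{f_i\sim p_i}\big[V_i(\max(f_i-s_i,0))\big] \;:\; s_i\ge 0\ \forall i,\ \sum_{i=1}^m s_i\le \bar c\Big\}.$$ (c) If $(\hat s_1,\dots,\hat s_m)$ solves the minimization problem in (a) (respectively (b)) within an optimality gap $\Delta$ (that is, it is feasible and its objective value exceeds the minimum by at most $\Delta$), then the simple policy $S_i(t)=\hat s_i\,\frac{c(t)}{\bar c}$ solves, within an optimality gap $\Delta$, the problem of minimizing over allowable policies the long-term average dissatisfaction $\frac1m\sum_{i=1}^m V_i(\bar\kappa_i)$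 (respectively the expected long-term average dissatisfaction $\frac1m\sum_{i=1}^m \mathbb E_{f_i\sim p_i}[V_i(\bar\kappa_i)]$).
   Context: Time is discrete, $t\in\{1,2,\dots\}$. At time $t$ the server has $c(t)\ge0$ units of resource (a deterministic sequence or a random process), and $\bar c=\lim_{T\to\infty}\frac1T\sum_{t=1}^T c(t)$ exists (almost surely) and is constant. User $i$ receives $S_i(t)\ge0$ units, with $\sum_{i=1}^m S_i(t)\le c(t)$ for every $t$, stores them in an infinite-capacity buffer with occupancy $Q_i(t)\ge0$, and then tries to consume $F_i(t)\ge 0$ units. With $(x)^+=\max(x,0)$, $$Q_i(t+1)=(Q_i(t)+S_i(t)-F_i(t))^+,\qquad \kappa_i(t)=\big(F_i(t)-(Q_i(t)+S_i(t))\big)^+ ,$$ where $\kappa_i(t)$ is the shortfall at time $t$, and the average shortfall is $\bar\kappa_i=\lim_{T\to\infty}\frac1T\sum_{t=1}^T\kappa_i(t)$. Assumptions on consumption: for each $i$, $f_i=\lim_{T\to\infty}\frac1T\sum_{t=1}^T F_i(t)$ is well defined, and $\max_{i,t}F_i(t)$ is bounded almost surely. Allowable policy: a process $\{S_i(t)\}$ of allocations satisfying the capacity constraint $\sum_i S_i(t)\le c(t)$ for all $t$ and having, for every user $i$, a well-defined long-term average $s_i=\lim_{T\to\infty}\frac1T\sum_{t=1}^T S_i(t)$. For the lower bounds, a policy may use knowledge of the buffer history $\{Q_i(\tau):\tau\le t\}$.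
   Formalization: In (b) and its half of (c), allowable policies are restricted to those whose long-term average s_i is independent of the same user's unknown f_i; otherwise a policy could learn f from the buffer history and beat the stated minimum. *)

theory Defs
  imports "HOL-Probability.Probability"
begin

text \<open>
  Users form a finite type \<open>'u\<close>, so that \<open>CARD('u) \<ge> 1\<close> is the number of users.  Processes are indexed
  by \<open>nat\<close> but time starts at 1: the value of a process at index 0 is never used.
\<close>

definition time_avg :: "(nat \<Rightarrow> real) \<Rightarrow> nat \<Rightarrow> real" where
  "time_avg x T = (\<Sum>t = 1..T. x t) / real T"

text \<open>Meaningful only if \<open>convergent (time_avg x)\<close>.\<close>

definition lim_avg :: "(nat \<Rightarrow> real) \<Rightarrow> real" where
  "lim_avg x = lim (time_avg x)"

text \<open>
  Buffer occupancy of one user along one sample path.  The occupancy at time 1 is \<open>q\<close>; the value at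
  index 0 is a dummy.
\<close>

primrec buffer :: "real \<Rightarrow> (nat \<Rightarrow> real) \<Rightarrow> (nat \<Rightarrow> real) \<Rightarrow> nat \<Rightarrow> real" where
  "buffer q S F 0 = q"
| "buffer q S F (Suc t) = (if t = 0 then q else max (buffer q S F t + S t - F t) 0)"

definition shortfall :: "real \<Rightarrow> (nat \<Rightarrow> real) \<Rightarrow> (nat \<Rightarrow> real) \<Rightarrow> nat \<Rightarrow> real" where
  "shortfall q S F t = max (F t - (buffer q S F t + S t)) 0"

definition avg_shortfall :: "real \<Rightarrow> (nat \<Rightarrow> real) \<Rightarrow> (nat \<Rightarrow> real) \<Rightarrow> real" where
  "avg_shortfall q S F = lim_avg (shortfall q S F)"

text \<open>
  Allowable policies.  The allocations may depend on the sample point in an arbitrary measurable way,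
  in particular on the buffer history.  The long-term averages exist almost surely and may be random.
\<close>

definition allowable :: "'a measure \<Rightarrow> (nat \<Rightarrow> 'a \<Rightarrow> real) \<Rightarrow> ('u::finite \<Rightarrow> nat \<Rightarrow> 'a \<Rightarrow> real) set" where
  "allowable M c = {S.
     (\<forall>i. \<forall>t\<ge>1. S i t \<in> borel_measurable M) \<and>
     (\<forall>i. \<forall>t\<ge>1. \<forall>\<omega>\<in>space M. 0 \<le> S i t \<omega>) \<and>
     (\<forall>t\<ge>1. \<forall>\<omega>\<in>space M. (\<Sum>i\<in>UNIV. S i t \<omega>) \<le> c t \<omega>) \<and>
     (\<forall>i. AE \<omega> in M. convergent (time_avg (\<lambda>t. S i t \<omega>)))}"

text \<open>
  Allowable policies when the mean consumptions \<open>f i\<close> are unknown, i.e. random: the long-term average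
  allocated to user \<open>i\<close> must not depend on the realization of \<open>f i\<close>.  Deterministic long-term averages
  are a special case.  Only the long-term averages are restricted; each \<open>S i t\<close> may still depend on
  the past consumption.  Without this restriction a policy could learn \<open>f\<close> from the buffer history,
  allocate optimally for the realized \<open>f\<close>, and thereby beat every fixed vector of average allocations.
\<close>

definition allowable_unknown ::
  "'a measure \<Rightarrow> (nat \<Rightarrow> 'a \<Rightarrow> real) \<Rightarrow> ('u::finite \<Rightarrow> 'a \<Rightarrow> real) \<Rightarrow> ('u \<Rightarrow> nat \<Rightarrow> 'a \<Rightarrow> real) set" where
  "allowable_unknown M c f = {S \<in> allowable M c.
     \<forall>i. prob_space.indep_var M borel (\<lambda>\<omega>. lim_avg (\<lambda>t. S i t \<omega>)) borel (f i)}"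

definition simple_policy ::
  "(nat \<Rightarrow> 'a \<Rightarrow> real) \<Rightarrow> real \<Rightarrow> ('u \<Rightarrow> real) \<Rightarrow> 'u \<Rightarrow> nat \<Rightarrow> 'a \<Rightarrow> real" where
  "simple_policy c cbar s i t \<omega> = s i * (c t \<omega> / cbar)"

definition dissatisfaction ::
  "('u::finite \<Rightarrow> real \<Rightarrow> real) \<Rightarrow> ('u \<Rightarrow> 'a \<Rightarrow> real) \<Rightarrow> ('u \<Rightarrow> nat \<Rightarrow> 'a \<Rightarrow> real) \<Rightarrow>
   ('u \<Rightarrow> nat \<Rightarrow> 'a \<Rightarrow> real) \<Rightarrow> 'a \<Rightarrow> real" where
  "dissatisfaction V q F S \<omega> =
     (\<Sum>i\<in>UNIV. V i (avg_shortfall (q i \<omega>) (\<lambda>t. S i t \<omega>) (\<lambda>t. F i t \<omega>))) / real CARD('u)"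

text \<open>
  Expectations of the nonnegative quantities \<open>V i _\<close> are taken in \<open>[0,\<infinity>]\<close>, since \<open>f i\<close> need not be
  integrable when the almost sure bound on the consumptions depends on the sample path.
\<close>

definition expected_dissatisfaction ::
  "'a measure \<Rightarrow> ('u::finite \<Rightarrow> real \<Rightarrow> real) \<Rightarrow> ('u \<Rightarrow> 'a \<Rightarrow> real) \<Rightarrow>
   ('u \<Rightarrow> nat \<Rightarrow> 'a \<Rightarrow> real) \<Rightarrow> ('u \<Rightarrow> nat \<Rightarrow> 'a \<Rightarrow> real) \<Rightarrow> ennreal" where
  "expected_dissatisfaction M V q F S =
     (\<Sum>i\<in>UNIV. \<integral>\<^sup>+\<omega>. ennreal (V i (avg_shortfall (q i \<omega>) (\<lambda>t. S i t \<omega>) (\<lambda>t. F i t \<omega>))) \<partial>M)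
       / of_nat CARD('u)"

definition feasible :: "real \<Rightarrow> ('u::finite \<Rightarrow> real) set" where
  "feasible cbar = {s. (\<forall>i. 0 \<le> s i) \<and> (\<Sum>i\<in>UNIV. s i) \<le> cbar}"

definition objective_known ::
  "('u::finite \<Rightarrow> real \<Rightarrow> real) \<Rightarrow> ('u \<Rightarrow> real) \<Rightarrow> ('u \<Rightarrow> real) \<Rightarrow> real" where
  "objective_known V f s = (\<Sum>i\<in>UNIV. V i (max (f i - s i) 0)) / real CARD('u)"

definition objective_unknown ::
  "('u::finite \<Rightarrow> real \<Rightarrow> real) \<Rightarrow> ('u \<Rightarrow> real measure) \<Rightarrow> ('u \<Rightarrow> real) \<Rightarrow> ennreal" where
  "objective_unknown V p s =
     (\<Sum>i\<in>UNIV. \<integral>\<^sup>+x. ennreal (V i (max (x - s i) 0)) \<partial>p i) / of_nat CARD('u)"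

end

theory Submission
  imports Defs
begin

text \<open>
  Along a sample path the total shortfall up to time \<open>T\<close> is the running maximum of \<open>0\<close> and the
  net deficits \<open>\<Sum>t\<le>k. (F t - S t) - q\<close>, \<open>k \<le> T\<close>: a unit of consumption is lost exactly when the
  deficit reaches a new record.  Since the deficit grows like \<open>(f - s) T\<close>, the
  average shortfall of every policy exists and equals \<open>max (f - s) 0\<close>
  (\<open>shortfall_average_tendsto\<close>).  The dissatisfaction of a policy is therefore a function of
  its long-term average allocations alone.  These form a feasible vector, by
  averaging the capacity constraint, and the simple policy realizes any prescribed feasible vector.

  When the means are known, the lower bound is now the definition of the minimum.  When they
  are unknown, the averages \<open>s i\<close> may be random, but each is independent of its own \<open>f i\<close>,
  so that \<open>f i\<close> can be integrated out first with \<open>s i\<close> held fixed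
  (\<open>nn_integral_indep_pair\<close>).  What remains is the expectation of the objective at the
  random vector \<open>s\<close>, which is almost surely feasible, and the objective is at least its minimum
  at every feasible point.  Because the objective is a sum of one term per user, independence has
  to be used only for one user at a time, although the \<open>s i\<close> are coupled by the capacity constraint.

  That the minimum is attained is a compactness argument.  The cost \<open>V (max y 0)\<close> may jump
  up at \<open>y = 0\<close>, but concavity on the half-line makes it lower semicontinuous, and Fatou's lemma
  carries this over to expectations (\<open>expected_cost_minimizer\<close>).  Known means are the case of
  point-mass priors.
\<close>

section \<open>Average shortfall along a sample path\<close>

text \<open>
  Adding the shortfall undoes the truncation at \<open>0\<close>, which makes the buffer recursion linear and
  lets it be summed over time.
\<close>

lemma buffer_balance:
  "buffer q S F (Suc T) = q + (\<Sum>t = 1..T. S t - F t) + (\<Sum>t = 1..T. shortfall q S F t)"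
proof (induction T)
  case 0
  then show ?case by simp
next
  case (Suc T)
  have "buffer q S F (Suc (Suc T)) = buffer q S F (Suc T) + (S (Suc T) - F (Suc T))
      + shortfall q S F (Suc T)"
    by (simp add: shortfall_def max_def)
  then show ?case unfolding Suc.IH by simp
qed

text \<open>
  The total shortfall grows only when the net deficit exceeds it, and then catches up with it exactly.
\<close>

lemma total_shortfall_Suc:
  "(\<Sum>t = 1..Suc T. shortfall q S F t)
     = max (\<Sum>t = 1..T. shortfall q S F t) ((\<Sum>t = 1..Suc T. F t - S t) - q)"
proof -
  have "F (Suc T) - (buffer q S F (Suc T) + S (Suc T))
      = (\<Sum>t = 1..Suc T. F t - S t) - q - (\<Sum>t = 1..T. shortfall q S F t)"
    by (simp add: buffer_balance sum_subtractf del: buffer.simps)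
  then have "shortfall q S F (Suc T)
      = max ((\<Sum>t = 1..Suc T. F t - S t) - q - (\<Sum>t = 1..T. shortfall q S F t)) 0"
    by (simp only: shortfall_def[of q S F "Suc T"])
  then show ?thesis by simp
qed

text \<open>
  A running maximum follows a deficit of positive drift at the same rate, and grows sublinearly
  if the drift is not positive.
\<close>

lemma running_maximum_average_tendsto:
  fixes K D :: "nat \<Rightarrow> real"
  assumes K0: "K 0 = 0" and K_Suc: "\<And>T. K (Suc T) = max (K T) (D (Suc T))"
    and D: "(\<lambda>T. D T / real T) \<longlonglongrightarrow> d"
  shows "(\<lambda>T. K T / real T) \<longlonglongrightarrow> max d 0"
proof (rule order_tendstoI)
  fix a assume a: "a < max d 0"
  have K_ge: "max (D T) 0 \<le> K T" if "T \<ge> 1" for T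
  proof -
    have "0 \<le> K n" for n by (induction n) (simp_all add: K0 K_Suc)
    moreover have "D T \<le> K T" using that by (cases T) (auto simp: K_Suc)
    ultimately show ?thesis by simp
  qed
  have "(\<lambda>T. max (D T / real T) 0) \<longlonglongrightarrow> max d 0"
    by (intro tendsto_intros D)
  then have "\<forall>\<^sub>F T in sequentially. a < max (D T / real T) 0"
    using a by (rule order_tendstoD)
  then show "\<forall>\<^sub>F T in sequentially. a < K T / real T"
    using eventually_ge_at_top[of 1]
  proof eventually_elim
    case (elim T)
    have "max (D T / real T) 0 = max (D T) 0 / real T"
      using elim by (auto simp: max_def field_simps)
    also have "\<dots> \<le> K T / real T" using K_ge elim by (intro divide_right_mono) auto
    finally show ?case using elim by linarith
  qed
next
  fix a assume a: "max d 0 < a"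
  then obtain b where b: "max d 0 < b" "b < a" using dense by blast
  then have "\<forall>\<^sub>F T in sequentially. D T / real T < b"
    using D by (intro order_tendstoD(2)[of _ d]) auto
  then obtain N where N: "\<And>T. T \<ge> N \<Longrightarrow> D T / real T < b"
    by (auto simp: eventually_sequentially)
  \<comment> \<open>After \<open>N\<close> every new record is below the line \<open>b T\<close>, so \<open>K\<close> exceeds it by at most \<open>K N\<close>.\<close>
  have K_le: "K T \<le> K N + b * real T" if "T \<ge> N" for T
    using that
  proof (induction T rule: dec_induct)
    case base
    then show ?case using b by simp
  next
    case (step T)
    have KN: "0 \<le> K N" by (induction N) (simp_all add: K0 K_Suc)
    have "D (Suc T) / real (Suc T) < b" using step by (intro N) auto
    then have "D (Suc T) \<le> b * real (Suc T)" by (simp add: pos_divide_less_eq del: of_nat_Suc)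
    moreover have "b * real T \<le> b * real (Suc T)" using b by (intro mult_left_mono) auto
    ultimately show ?case using step.IH KN by (simp add: K_Suc del: of_nat_Suc)
  qed
  have "(\<lambda>T. K N / real T + b) \<longlonglongrightarrow> 0 + b"
    by (intro tendsto_intros tendsto_divide_0[OF tendsto_const]
        filterlim_at_top_imp_at_infinity filterlim_real_sequentially)
  then have "\<forall>\<^sub>F T in sequentially. K N / real T + b < a"
    using b by (intro order_tendstoD) auto
  then show "\<forall>\<^sub>F T in sequentially. K T / real T < a"
    using eventually_ge_at_top[of "max N 1"]
  proof eventually_elim
    case (elim T)
    then have "K T / real T \<le> (K N + b * real T) / real T"
      using K_le by (intro divide_right_mono) auto
    also have "\<dots> = K N / real T + b" using elim by (simp add: field_simps)
    finally show ?case using elim by linarith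
  qed
qed

lemma shortfall_average_tendsto:
  assumes F: "time_avg F \<longlonglongrightarrow> f" and S: "time_avg S \<longlonglongrightarrow> s"
  shows "time_avg (shortfall q S F) \<longlonglongrightarrow> max (f - s) 0"
proof -
  have "(\<lambda>T. time_avg F T - time_avg S T - q / real T) \<longlonglongrightarrow> f - s - 0"
    by (intro tendsto_intros F S tendsto_divide_0[OF tendsto_const]
        filterlim_at_top_imp_at_infinity filterlim_real_sequentially)
  then have "(\<lambda>T. ((\<Sum>t = 1..T. F t - S t) - q) / real T) \<longlonglongrightarrow> f - s"
    by (simp add: time_avg_def diff_divide_distrib sum_subtractf)
  then have "(\<lambda>T. (\<Sum>t = 1..T. shortfall q S F t) / real T) \<longlonglongrightarrow> max (f - s) 0"
    by (rule running_maximum_average_tendsto[rotated 2]) (simp, rule total_shortfall_Suc)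
  then show ?thesis by (simp add: time_avg_def[abs_def])
qed

section \<open>Long-term averages of allowable policies\<close>

lemma lim_avg_eq: "time_avg x \<longlonglongrightarrow> l \<Longrightarrow> lim_avg x = l"
  unfolding lim_avg_def by (rule limI)

lemma convergent_time_avg: "convergent (time_avg x) \<Longrightarrow> time_avg x \<longlonglongrightarrow> lim_avg x"
  unfolding lim_avg_def by (simp add: convergent_LIMSEQ_iff)

lemma lim_avg_feasible:
  fixes S :: "'u::finite \<Rightarrow> nat \<Rightarrow> real"
  assumes nonneg: "\<And>i t. t \<ge> 1 \<Longrightarrow> 0 \<le> S i t"
    and cap: "\<And>t. t \<ge> 1 \<Longrightarrow> (\<Sum>i\<in>UNIV. S i t) \<le> c t"
    and c: "time_avg c \<longlonglongrightarrow> cbar"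
    and S: "\<And>i. time_avg (S i) \<longlonglongrightarrow> s i"
  shows "s \<in> feasible cbar"
proof -
  have "0 \<le> s i" for i
    using S by (rule LIMSEQ_le_const) (auto simp: time_avg_def intro!: divide_nonneg_nonneg sum_nonneg nonneg)
  moreover have "(\<Sum>i\<in>UNIV. s i) \<le> cbar"
  proof (rule LIMSEQ_le[OF tendsto_sum c])
    show "time_avg (S i) \<longlonglongrightarrow> s i" for i by (rule S)
    have "(\<Sum>i\<in>UNIV. time_avg (S i) T) = (\<Sum>t = 1..T. \<Sum>i\<in>UNIV. S i t) / real T" for T
      unfolding time_avg_def sum_divide_distrib[symmetric] by (subst sum.swap) simp
    also have "\<dots> T \<le> time_avg c T" for T
      unfolding time_avg_def by (intro divide_right_mono sum_mono cap) auto
    finally show "\<exists>N. \<forall>T\<ge>N. (\<Sum>i\<in>UNIV. time_avg (S i) T) \<le> time_avg c T" by blast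
  qed
  ultimately show ?thesis by (simp add: feasible_def)
qed

lemma allowable_averages:
  fixes S :: "'u::finite \<Rightarrow> nat \<Rightarrow> 'a \<Rightarrow> real"
  assumes S: "S \<in> allowable M c"
    and c: "AE \<omega> in M. time_avg (\<lambda>t. c t \<omega>) \<longlonglongrightarrow> cbar"
  shows "AE \<omega> in M. (\<forall>i. time_avg (\<lambda>t. S i t \<omega>) \<longlonglongrightarrow> lim_avg (\<lambda>t. S i t \<omega>))
    \<and> (\<lambda>i. lim_avg (\<lambda>t. S i t \<omega>)) \<in> feasible cbar"
proof -
  have "AE \<omega> in M. \<forall>i. convergent (time_avg (\<lambda>t. S i t \<omega>))"
    using S by (intro eventually_all_finite) (auto simp: allowable_def)
  then show ?thesis using c AE_space
  proof eventually_elim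
    case (elim \<omega>)
    then have lims: "\<And>i. time_avg (\<lambda>t. S i t \<omega>) \<longlonglongrightarrow> lim_avg (\<lambda>t. S i t \<omega>)"
      by (intro convergent_time_avg) auto
    moreover have "(\<lambda>i. lim_avg (\<lambda>t. S i t \<omega>)) \<in> feasible cbar"
      using S elim by (intro lim_avg_feasible[OF _ _ elim(2) lims]) (auto simp: allowable_def)
    ultimately show ?case by blast
  qed
qed

lemma allowable_shortfall:
  fixes S :: "'u::finite \<Rightarrow> nat \<Rightarrow> 'a \<Rightarrow> real"
  assumes S: "S \<in> allowable M c"
    and c: "AE \<omega> in M. time_avg (\<lambda>t. c t \<omega>) \<longlonglongrightarrow> cbar"
    and F: "\<And>i. AE \<omega> in M. time_avg (\<lambda>t. F i t \<omega>) \<longlonglongrightarrow> f i \<omega>"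
  shows "AE \<omega> in M. \<forall>i. time_avg (shortfall (q i \<omega>) (\<lambda>t. S i t \<omega>) (\<lambda>t. F i t \<omega>))
    \<longlonglongrightarrow> max (f i \<omega> - lim_avg (\<lambda>t. S i t \<omega>)) 0"
proof -
  have "AE \<omega> in M. \<forall>i. time_avg (\<lambda>t. F i t \<omega>) \<longlonglongrightarrow> f i \<omega>"
    by (intro eventually_all_finite F)
  with allowable_averages[OF S c] show ?thesis
    by eventually_elim (auto intro: shortfall_average_tendsto)
qed

lemma simple_policy_average:
  assumes "time_avg (\<lambda>t. c t \<omega>) \<longlonglongrightarrow> cbar" "cbar > 0"
  shows "time_avg (\<lambda>t. simple_policy c cbar s i t \<omega>) \<longlonglongrightarrow> s i"
proof -
  have "(\<lambda>T. s i / cbar * time_avg (\<lambda>t. c t \<omega>) T) \<longlonglongrightarrow> s i / cbar * cbar"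
    by (intro tendsto_intros assms)
  moreover have "(\<lambda>T. s i / cbar * time_avg (\<lambda>t. c t \<omega>) T)
      = time_avg (\<lambda>t. simple_policy c cbar s i t \<omega>)"
    by (simp add: time_avg_def simple_policy_def fun_eq_iff sum_distrib_left)
  ultimately show ?thesis using assms by simp
qed

lemma simple_policy_lim_avg:
  assumes "AE \<omega> in M. time_avg (\<lambda>t. c t \<omega>) \<longlonglongrightarrow> cbar" "cbar > 0"
  shows "AE \<omega> in M. lim_avg (\<lambda>t. simple_policy c cbar s i t \<omega>) = s i"
  using assms(1) by eventually_elim (intro lim_avg_eq simple_policy_average assms)

lemma simple_policy_allowable:
  assumes c_meas: "\<And>t. t \<ge> 1 \<Longrightarrow> c t \<in> borel_measurable M"
    and c_nonneg: "\<And>t \<omega>. t \<ge> 1 \<Longrightarrow> \<omega> \<in> space M \<Longrightarrow> 0 \<le> c t \<omega>"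
    and c_avg: "AE \<omega> in M. time_avg (\<lambda>t. c t \<omega>) \<longlonglongrightarrow> cbar"
    and cbar: "cbar > 0" and s: "s \<in> feasible cbar"
  shows "simple_policy c cbar s \<in> allowable M c"
proof -
  have "simple_policy c cbar s i t \<in> borel_measurable M" if "t \<ge> 1" for i t
    using c_meas[OF that] by (simp add: simple_policy_def[abs_def])
  moreover have "0 \<le> simple_policy c cbar s i t \<omega>" if "t \<ge> 1" "\<omega> \<in> space M" for i t \<omega>
    using c_nonneg[OF that] cbar s by (simp add: simple_policy_def feasible_def)
  moreover have "(\<Sum>i\<in>UNIV. simple_policy c cbar s i t \<omega>) \<le> c t \<omega>"
    if "t \<ge> 1" "\<omega> \<in> space M" for t \<omega>
  proof -
    have "(\<Sum>i\<in>UNIV. s i) * (c t \<omega> / cbar) \<le> cbar * (c t \<omega> / cbar)"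
      using c_nonneg[OF that] cbar s by (intro mult_right_mono) (auto simp: feasible_def)
    then show ?thesis using cbar by (simp add: simple_policy_def sum_distrib_right sum_divide_distrib)
  qed
  moreover have "AE \<omega> in M. convergent (time_avg (\<lambda>t. simple_policy c cbar s i t \<omega>))" for i
    using c_avg by eventually_elim (rule convergentI, rule simple_policy_average[OF _ cbar])
  ultimately show ?thesis by (simp add: allowable_def)
qed

section \<open>Independence\<close>

lemma (in prob_space) indep_var_AE_const:
  assumes X: "X \<in> measurable M N" and Y: "Y \<in> measurable M L"
    and const: "AE \<omega> in M. X \<omega> = k"
  shows "indep_var N X L Y"
proof -
  interpret X: prob_space "distr M N X" using X by (rule prob_space_distr)
  interpret Y: prob_space "distr M L Y" using Y by (rule prob_space_distr)
  have "distr M N X \<Otimes>\<^sub>M distr M L Y = distr M (N \<Otimes>\<^sub>M L) (\<lambda>\<omega>. (X \<omega>, Y \<omega>))"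
  proof (rule pair_measure_eqI)
    fix A B assume "A \<in> sets (distr M N X)" "B \<in> sets (distr M L Y)"
    then have A: "A \<in> sets N" and B: "B \<in> sets L" by auto
    have pair: "emeasure (distr M (N \<Otimes>\<^sub>M L) (\<lambda>\<omega>. (X \<omega>, Y \<omega>))) (A \<times> B)
        = emeasure M (X -` A \<inter> space M \<inter> (Y -` B \<inter> space M))"
      using X Y A B by (subst emeasure_distr) (auto intro!: arg_cong[where f="emeasure M"])
    show "emeasure (distr M N X) A * emeasure (distr M L Y) B
        = emeasure (distr M (N \<Otimes>\<^sub>M L) (\<lambda>\<omega>. (X \<omega>, Y \<omega>))) (A \<times> B)"
    proof (cases "k \<in> A")
      case True
      have "emeasure M (X -` A \<inter> space M) = 1"
        using const X A True by (intro emeasure_eq_1_AE) auto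
      moreover have "emeasure M (X -` A \<inter> space M \<inter> (Y -` B \<inter> space M)) = emeasure M (Y -` B \<inter> space M)"
        using const X Y A B True by (intro emeasure_eq_AE) auto
      ultimately show ?thesis using X Y A B unfolding pair by (simp add: emeasure_distr)
    next
      case False
      have "emeasure M (X -` A \<inter> space M) = emeasure M {}"
        using const X A False by (intro emeasure_eq_AE) auto
      moreover have "emeasure M (X -` A \<inter> space M \<inter> (Y -` B \<inter> space M)) = emeasure M {}"
        using const X Y A B False by (intro emeasure_eq_AE) auto
      ultimately show ?thesis using X Y A B unfolding pair by (simp add: emeasure_distr)
    qed
  qed (auto simp: X.sigma_finite_measure_axioms Y.sigma_finite_measure_axioms cong: sets_pair_measure_cong)
  with X Y show ?thesis by (simp add: indep_var_distribution_eq)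
qed

text \<open>Fubini's theorem, with the outer integral pulled back from the law of \<open>X\<close> to the sample space.\<close>

lemma (in prob_space) nn_integral_indep_pair:
  assumes ind: "indep_var N X L Y" and h: "h \<in> borel_measurable (N \<Otimes>\<^sub>M L)"
  shows "(\<integral>\<^sup>+\<omega>. h (X \<omega>, Y \<omega>) \<partial>M) = (\<integral>\<^sup>+\<omega>. (\<integral>\<^sup>+y. h (X \<omega>, y) \<partial>distr M L Y) \<partial>M)"
proof -
  have X: "X \<in> measurable M N" and Y: "Y \<in> measurable M L"
    and prod: "distr M (N \<Otimes>\<^sub>M L) (\<lambda>\<omega>. (X \<omega>, Y \<omega>)) = distr M N X \<Otimes>\<^sub>M distr M L Y"
    using ind by (auto simp: indep_var_distribution_eq)
  interpret Y: prob_space "distr M L Y" using Y by (rule prob_space_distr)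
  have h': "h \<in> borel_measurable (N \<Otimes>\<^sub>M distr M L Y)"
    using h by (simp cong: measurable_cong_sets sets_pair_measure_cong)
  have h'': "h \<in> borel_measurable (distr M N X \<Otimes>\<^sub>M distr M L Y)"
    using h by (simp cong: measurable_cong_sets sets_pair_measure_cong)
  have "(\<integral>\<^sup>+\<omega>. h (X \<omega>, Y \<omega>) \<partial>M) = integral\<^sup>N (distr M N X \<Otimes>\<^sub>M distr M L Y) h"
    unfolding prod[symmetric] using X Y h by (subst nn_integral_distr) auto
  also have "\<dots> = (\<integral>\<^sup>+x. (\<integral>\<^sup>+y. h (x, y) \<partial>distr M L Y) \<partial>distr M N X)"
    using h'' by (rule Y.nn_integral_fst[symmetric])
  also have "\<dots> = (\<integral>\<^sup>+\<omega>. (\<integral>\<^sup>+y. h (X \<omega>, y) \<partial>distr M L Y) \<partial>M)"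
    using X Y.borel_measurable_nn_integral_fst[OF h'] by (subst nn_integral_distr) auto
  finally show ?thesis .
qed

text \<open>
  The average allocation of the simple policy is almost surely constant, hence independent of
  everything.
\<close>

lemma simple_policy_allowable_unknown:
  assumes M: "prob_space M"
    and c_meas: "\<And>t. t \<ge> 1 \<Longrightarrow> c t \<in> borel_measurable M"
    and c_nonneg: "\<And>t \<omega>. t \<ge> 1 \<Longrightarrow> \<omega> \<in> space M \<Longrightarrow> 0 \<le> c t \<omega>"
    and c_avg: "AE \<omega> in M. time_avg (\<lambda>t. c t \<omega>) \<longlonglongrightarrow> cbar"
    and cbar: "cbar > 0" and s: "s \<in> feasible cbar"
    and f: "\<And>i. f i \<in> borel_measurable M"
  shows "simple_policy c cbar s \<in> allowable_unknown M c f"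
proof -
  interpret prob_space M by fact
  have meas: "(\<lambda>\<omega>. lim_avg (\<lambda>t. simple_policy c cbar s i t \<omega>)) \<in> borel_measurable M" for i
  proof -
    have "(\<lambda>\<omega>. \<Sum>t = 1..T. s i * (c t \<omega> / cbar)) \<in> borel_measurable M" for T
      using c_meas by (intro borel_measurable_sum borel_measurable_times borel_measurable_divide) auto
    then show ?thesis
      unfolding lim_avg_def time_avg_def simple_policy_def
      by (intro borel_measurable_lim_metric borel_measurable_divide) auto
  qed
  have "indep_var borel (\<lambda>\<omega>. lim_avg (\<lambda>t. simple_policy c cbar s i t \<omega>)) borel (f i)" for i
    by (rule indep_var_AE_const[OF meas f simple_policy_lim_avg[OF c_avg cbar]])
  with simple_policy_allowable[of c M, OF c_meas c_nonneg c_avg cbar s] show ?thesis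
    by (simp add: allowable_unknown_def)
qed

section \<open>Existence of optimal average allocations\<close>

text \<open>
  Continuity can fail at \<open>y = 0\<close>, where \<open>V\<close> may jump up.  For \<open>y > 0\<close> the chord from the origin gives
  \<open>V z \<ge> (z / y) V y\<close> for \<open>0 \<le> z \<le> y\<close>, which bounds the values at points near \<open>y\<close> from below.
\<close>

lemma concave_cost_lower_semicontinuous:
  fixes V :: "real \<Rightarrow> real"
  assumes mono: "mono_on {0..} V" and conc: "concave_on {0..} V"
    and zero: "V 0 = 0"
    and y: "y \<longlonglongrightarrow> l"
  shows "ennreal (V (max l 0)) \<le> liminf (\<lambda>n. ennreal (V (max (y n) 0)))"
proof (cases "l \<le> 0")
  case True
  then show ?thesis by (simp add: max_def zero)
next
  case False
  then have l: "0 < l" by simp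
  define r where "r n = min 1 (max (y n) 0 / l)" for n
  have r: "0 \<le> r n" "r n \<le> 1" "r n * l \<le> max (y n) 0" for n
    using l by (auto simp: r_def min_def field_simps)
  have lower: "r n * V l \<le> V (max (y n) 0)" for n
  proof -
    have "(1 - r n) * V 0 + r n * V l \<le> V ((1 - r n) *\<^sub>R 0 + r n *\<^sub>R l)"
      using concave_onD[OF conc, of "r n" 0 l] r l by simp
    also have "\<dots> \<le> V (max (y n) 0)"
      using r l by (intro mono_onD[OF mono]) auto
    finally show ?thesis by (simp add: zero)
  qed
  have "(\<lambda>n. r n * V l) \<longlonglongrightarrow> min 1 (max l 0 / l) * V l"
    unfolding r_def using l by (intro tendsto_intros y) auto
  then have "(\<lambda>n. ennreal (r n * V l)) \<longlonglongrightarrow> ennreal (V l)"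
    using l by (intro tendsto_ennrealI) simp
  then have "ennreal (V l) = liminf (\<lambda>n. ennreal (r n * V l))"
    by (intro lim_imp_Liminf[symmetric]) auto
  also have "\<dots> \<le> liminf (\<lambda>n. ennreal (V (max (y n) 0)))"
    by (intro Liminf_mono always_eventually allI ennreal_leI lower)
  finally show ?thesis using l by (simp add: max_def)
qed

lemma cost_measurable:
  assumes "mono_on {0..} (V :: real \<Rightarrow> real)"
  shows "(\<lambda>y. V (max y 0)) \<in> borel_measurable borel"
  by (rule borel_measurable_mono) (auto intro!: monoI mono_onD[OF assms])

text \<open>Fatou's lemma for the counting measure.\<close>

lemma finite_sum_liminf_le:
  fixes a :: "'u::finite \<Rightarrow> nat \<Rightarrow> ennreal"
  shows "(\<Sum>i\<in>UNIV. liminf (a i)) \<le> liminf (\<lambda>n. \<Sum>i\<in>UNIV. a i n)"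
  using nn_integral_liminf[of "\<lambda>n i. a i n" "count_space UNIV"]
  by (simp add: nn_integral_count_space_finite)

text \<open>
  The feasible set is compact; it is transported to Euclidean space, where closed and
  bounded sets are compact.
\<close>

lemma feasible_subsequence:
  fixes s :: "nat \<Rightarrow> 'u::finite \<Rightarrow> real"
  assumes s: "\<And>n. s n \<in> feasible cbar"
  obtains l r where "l \<in> feasible cbar" "strict_mono r" "\<And>i. (\<lambda>n. s (r n) i) \<longlonglongrightarrow> l i"
proof -
  define K :: "(real ^ 'u) set" where "K = {v. (\<forall>i. 0 \<le> v $ i) \<and> (\<Sum>i\<in>UNIV. v $ i) \<le> cbar}"
  have K_eq: "K = (\<Inter>i. {v. 0 \<le> v $ i}) \<inter> {v. (\<Sum>i\<in>UNIV. v $ i) \<le> cbar}"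
    by (auto simp: K_def)
  have "closed K"
    unfolding K_eq by (intro closed_Int closed_INT ballI closed_Collect_le continuous_intros)
  moreover have "bounded K"
    unfolding bounded_iff
  proof (intro exI ballI)
    fix v assume v: "v \<in> K"
    have "norm v \<le> (\<Sum>i\<in>UNIV. \<bar>v $ i\<bar>)" by (rule norm_le_l1_cart)
    also have "\<dots> \<le> cbar" using v by (simp add: K_def)
    finally show "norm v \<le> cbar" .
  qed
  ultimately have "compact K" by (simp add: compact_eq_bounded_closed)
  moreover have "\<forall>n. (\<chi> i. s n i) \<in> K"
    using s by (simp add: K_def feasible_def)
  ultimately obtain l r where l: "l \<in> K" and r: "strict_mono r"
    and lim: "((\<lambda>n. \<chi> i. s n i) \<circ> r) \<longlonglongrightarrow> l"
    by (meson compact_imp_seq_compact seq_compactE)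
  have "(\<lambda>n. s (r n) i) \<longlonglongrightarrow> l $ i" for i
    using tendsto_vec_nth[OF lim, of i] by simp
  with l r show thesis by (intro that[of "\<lambda>i. l $ i" r]) (auto simp: K_def feasible_def)
qed

text \<open>
  Along a convergent minimizing sequence, Fatou's lemma bounds the cost at the limit by the infimum.
\<close>

lemma expected_cost_minimizer:
  fixes V :: "'u::finite \<Rightarrow> real \<Rightarrow> real" and p :: "'u \<Rightarrow> real measure"
  assumes mono: "\<And>i. mono_on {0..} (V i)" and conc: "\<And>i. concave_on {0..} (V i)"
    and zero: "\<And>i. V i 0 = 0"
    and p: "\<And>i. sets (p i) = sets borel" and cbar: "0 \<le> cbar"
  obtains s where "s \<in> feasible cbar"
    "\<And>s'. s' \<in> feasible cbar \<Longrightarrow> objective_unknown V p s \<le> objective_unknown V p s'"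
proof -
  define G where "G s = (\<Sum>i\<in>UNIV. \<integral>\<^sup>+x. ennreal (V i (max (x - s i) 0)) \<partial>p i)" for s
  have "(\<lambda>i. 0) \<in> feasible cbar" using cbar by (simp add: feasible_def)
  then have "G ` feasible cbar \<noteq> {}" by blast
  from Inf_as_limit[OF this] obtain u
    where u: "\<forall>n. u n \<in> G ` feasible cbar" and u_lim: "u \<longlonglongrightarrow> Inf (G ` feasible cbar)"
    by (elim exE conjE)
  have "\<forall>n. \<exists>s. s \<in> feasible cbar \<and> u n = G s"
    using u by (auto simp: image_iff)
  from choice[OF this] obtain s where s: "\<And>n. s n \<in> feasible cbar" and us: "\<And>n. u n = G (s n)"
    by auto
  obtain l r where l: "l \<in> feasible cbar" and r: "strict_mono r"
    and sl: "\<And>i. (\<lambda>n. s (r n) i) \<longlonglongrightarrow> l i"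
    by (rule feasible_subsequence[where s = s and cbar = cbar, OF s]) blast
  have meas: "(\<lambda>x. ennreal (V i (max (x - a) 0))) \<in> borel_measurable (p i)" for i a
  proof -
    have "(\<lambda>x. V i (max (x - a) 0)) \<in> borel_measurable borel"
      by (rule measurable_compose[OF _ cost_measurable[OF mono]]) simp
    then show ?thesis using p by (simp cong: measurable_cong_sets)
  qed
  have "G l \<le> (\<Sum>i\<in>UNIV. \<integral>\<^sup>+x. liminf (\<lambda>n. ennreal (V i (max (x - s (r n) i) 0))) \<partial>p i)"
    unfolding G_def
    by (intro sum_mono nn_integral_mono
        concave_cost_lower_semicontinuous[OF mono conc zero] tendsto_intros sl)
  also have "\<dots> \<le> (\<Sum>i\<in>UNIV. liminf (\<lambda>n. \<integral>\<^sup>+x. ennreal (V i (max (x - s (r n) i) 0)) \<partial>p i))"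
    by (intro sum_mono nn_integral_liminf meas)
  also have "\<dots> \<le> liminf (\<lambda>n. G (s (r n)))"
    unfolding G_def by (rule finite_sum_liminf_le)
  also have "\<dots> = Inf (G ` feasible cbar)"
    using LIMSEQ_subseq_LIMSEQ[OF u_lim r] us by (intro lim_imp_Liminf) (auto simp: o_def)
  finally have "G l \<le> G s'" if "s' \<in> feasible cbar" for s'
    using that by (meson INF_lower order_trans)
  then show thesis
    using l by (intro that) (auto simp: objective_unknown_def G_def intro: divide_right_mono_ennreal)
qed

lemma objective_unknown_return:
  fixes V :: "'u::finite \<Rightarrow> real \<Rightarrow> real"
  assumes mono: "\<And>i. mono_on {0..} (V i)" and nonneg: "\<And>i x. 0 \<le> x \<Longrightarrow> 0 \<le> V i x"
  shows "objective_unknown V (\<lambda>i. return borel (f i)) s = ennreal (objective_known V f s)"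
proof -
  have "(\<lambda>x. V i (max (x - s i) 0)) \<in> borel_measurable borel" for i
    by (rule measurable_compose[OF _ cost_measurable[OF mono]]) simp
  then show ?thesis
    by (simp add: objective_unknown_def objective_known_def nn_integral_return nonneg
        sum_nonneg divide_ennreal[symmetric] ennreal_of_nat_eq_real_of_nat)
qed

lemma known_cost_minimizer:
  fixes V :: "'u::finite \<Rightarrow> real \<Rightarrow> real"
  assumes mono: "\<And>i. mono_on {0..} (V i)" and conc: "\<And>i. concave_on {0..} (V i)"
    and nonneg: "\<And>i x. 0 \<le> x \<Longrightarrow> 0 \<le> V i x" and zero: "\<And>i. V i 0 = 0" and cbar: "0 \<le> cbar"
  obtains s where "s \<in> feasible cbar"
    "\<And>s'. s' \<in> feasible cbar \<Longrightarrow> objective_known V f s \<le> objective_known V f s'"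
proof -
  have pos: "0 \<le> objective_known V f s" for s
    by (auto simp: objective_known_def intro!: divide_nonneg_nonneg sum_nonneg nonneg)
  obtain s where "s \<in> feasible cbar"
    "\<And>s'. s' \<in> feasible cbar \<Longrightarrow> objective_unknown V (\<lambda>i. return borel (f i)) s
       \<le> objective_unknown V (\<lambda>i. return borel (f i)) s'"
    by (rule expected_cost_minimizer[where V = V and p = "\<lambda>i. return borel (f i)" and cbar = cbar,
        OF mono conc zero _ cbar]) auto
  then show thesis
    by (intro that) (auto simp: objective_unknown_return[OF mono nonneg] ennreal_le_iff pos)
qed

section \<open>Dissatisfaction in terms of average allocations\<close>

lemma dissatisfaction_eq_objective:
  assumes S: "S \<in> allowable M c"
    and c: "AE \<omega> in M. time_avg (\<lambda>t. c t \<omega>) \<longlonglongrightarrow> cbar"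
    and F: "\<And>i. AE \<omega> in M. time_avg (\<lambda>t. F i t \<omega>) \<longlonglongrightarrow> f i"
  shows "AE \<omega> in M. dissatisfaction V q F S \<omega> = objective_known V f (\<lambda>i. lim_avg (\<lambda>t. S i t \<omega>))"
  using allowable_shortfall[OF S c, of F "\<lambda>i \<omega>. f i" q, OF F]
proof eventually_elim
  case (elim \<omega>)
  then have "avg_shortfall (q i \<omega>) (\<lambda>t. S i t \<omega>) (\<lambda>t. F i t \<omega>)
      = max (f i - lim_avg (\<lambda>t. S i t \<omega>)) 0" for i
    unfolding avg_shortfall_def by (intro lim_avg_eq) simp
  then show ?case by (simp add: dissatisfaction_def objective_known_def)
qed

text \<open>
  The allocated average is independent of the mean consumption of the same user, so the latter
  can be integrated out against its prior while the former stays fixed.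
\<close>

lemma expected_dissatisfaction_eq_objective:
  fixes V :: "'u::finite \<Rightarrow> real \<Rightarrow> real"
  assumes M: "prob_space M" and S: "S \<in> allowable_unknown M c f"
    and c: "AE \<omega> in M. time_avg (\<lambda>t. c t \<omega>) \<longlonglongrightarrow> cbar"
    and F: "\<And>i. AE \<omega> in M. time_avg (\<lambda>t. F i t \<omega>) \<longlonglongrightarrow> f i \<omega>"
    and mono: "\<And>i. mono_on {0..} (V i)"
  shows "expected_dissatisfaction M V q F S
    = (\<integral>\<^sup>+\<omega>. objective_unknown V (\<lambda>i. distr M borel (f i)) (\<lambda>i. lim_avg (\<lambda>t. S i t \<omega>)) \<partial>M)"
proof -
  interpret prob_space M by fact
  let ?s = "\<lambda>i \<omega>. lim_avg (\<lambda>t. S i t \<omega>)"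
  define h where "h i = (\<lambda>(a, x). ennreal (V i (max (x - a) 0)))" for i
  have S': "S \<in> allowable M c" and ind: "\<And>i. indep_var borel (?s i) borel (f i)"
    using S by (auto simp: allowable_unknown_def)
  have s_meas[measurable]: "?s i \<in> borel_measurable M" and f_meas[measurable]: "f i \<in> borel_measurable M" for i
    using ind[of i] by (auto simp: indep_var_distribution_eq)
  have h: "h i \<in> borel_measurable (borel \<Otimes>\<^sub>M borel)" for i
  proof -
    have "(\<lambda>z. V i (max (snd z - fst z) 0)) \<in> borel_measurable (borel \<Otimes>\<^sub>M borel)"
      by (rule measurable_compose[OF _ cost_measurable[OF mono]]) measurable
    then show ?thesis by (simp add: h_def case_prod_beta')
  qed
  have inner: "(\<lambda>\<omega>. \<integral>\<^sup>+x. h i (?s i \<omega>, x) \<partial>distr M borel (f i)) \<in> borel_measurable M" for i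
  proof -
    interpret f: prob_space "distr M borel (f i)" by (rule prob_space_distr) simp
    have "h i \<in> borel_measurable (borel \<Otimes>\<^sub>M distr M borel (f i))"
      using h by (simp cong: measurable_cong_sets sets_pair_measure_cong)
    from measurable_compose[OF s_meas f.borel_measurable_nn_integral_fst[OF this]]
    show ?thesis .
  qed
  have "(\<integral>\<^sup>+\<omega>. ennreal (V i (avg_shortfall (q i \<omega>) (\<lambda>t. S i t \<omega>) (\<lambda>t. F i t \<omega>))) \<partial>M)
      = (\<integral>\<^sup>+\<omega>. h i (?s i \<omega>, f i \<omega>) \<partial>M)" for i
  proof (rule nn_integral_cong_AE)
    show "AE \<omega> in M. ennreal (V i (avg_shortfall (q i \<omega>) (\<lambda>t. S i t \<omega>) (\<lambda>t. F i t \<omega>)))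
        = h i (?s i \<omega>, f i \<omega>)"
      using allowable_shortfall[OF S' c, of F f q, OF F]
    proof eventually_elim
      case (elim \<omega>)
      then have "avg_shortfall (q i \<omega>) (\<lambda>t. S i t \<omega>) (\<lambda>t. F i t \<omega>)
          = max (f i \<omega> - lim_avg (\<lambda>t. S i t \<omega>)) 0"
        unfolding avg_shortfall_def by (intro lim_avg_eq) simp
      then show ?case by (simp add: h_def)
    qed
  qed
  also have "\<dots> i = (\<integral>\<^sup>+\<omega>. (\<integral>\<^sup>+x. h i (?s i \<omega>, x) \<partial>distr M borel (f i)) \<partial>M)" for i
    by (rule nn_integral_indep_pair[OF ind h])
  finally have "expected_dissatisfaction M V q F S
      = (\<integral>\<^sup>+\<omega>. (\<Sum>i\<in>UNIV. \<integral>\<^sup>+x. h i (?s i \<omega>, x) \<partial>distr M borel (f i)) \<partial>M) / of_nat CARD('u)"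
    using inner by (simp add: expected_dissatisfaction_def nn_integral_sum)
  also have "\<dots> = (\<integral>\<^sup>+\<omega>. (\<Sum>i\<in>UNIV. \<integral>\<^sup>+x. h i (?s i \<omega>, x) \<partial>distr M borel (f i)) / of_nat CARD('u) \<partial>M)"
    using inner by (intro nn_integral_divide[symmetric] borel_measurable_sum) auto
  finally show ?thesis by (simp add: objective_unknown_def h_def)
qed

theorem theorem1:
  fixes M :: "'a measure"
    and c :: "nat \<Rightarrow> 'a \<Rightarrow> real" and cbar :: real
    and F :: "'u::finite \<Rightarrow> nat \<Rightarrow> 'a \<Rightarrow> real"
    and q :: "'u \<Rightarrow> 'a \<Rightarrow> real"
    and V :: "'u \<Rightarrow> real \<Rightarrow> real"
  assumes "prob_space M"
    and c_meas: "\<And>t. t \<ge> 1 \<Longrightarrow> c t \<in> borel_measurable M"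
    and c_nonneg: "\<And>t \<omega>. t \<ge> 1 \<Longrightarrow> \<omega> \<in> space M \<Longrightarrow> 0 \<le> c t \<omega>"
    and c_avg: "AE \<omega> in M. time_avg (\<lambda>t. c t \<omega>) \<longlonglongrightarrow> cbar"
    and cbar_pos: "cbar > 0"
    and F_meas: "\<And>i t. t \<ge> 1 \<Longrightarrow> F i t \<in> borel_measurable M"
    and F_nonneg: "\<And>i t \<omega>. t \<ge> 1 \<Longrightarrow> \<omega> \<in> space M \<Longrightarrow> 0 \<le> F i t \<omega>"
    and F_bounded: "AE \<omega> in M. \<exists>B. \<forall>i. \<forall>t\<ge>1. F i t \<omega> \<le> B"
    and q_meas: "\<And>i. q i \<in> borel_measurable M"
    and q_nonneg: "\<And>i \<omega>. \<omega> \<in> space M \<Longrightarrow> 0 \<le> q i \<omega>"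
    and V_mono: "\<And>i. mono_on {0..} (V i)"
    and V_concave: "\<And>i. concave_on {0..} (V i)"
    and V_nonneg: "\<And>i x. 0 \<le> x \<Longrightarrow> 0 \<le> V i x"
    and V_zero: "\<And>i. V i 0 = 0"
  shows
    "(\<forall>f :: 'u \<Rightarrow> real.
       (\<forall>i. AE \<omega> in M. time_avg (\<lambda>t. F i t \<omega>) \<longlonglongrightarrow> f i) \<longrightarrow>
       (let Vbar = (INF s\<in>feasible cbar. objective_known V f s) in
         (\<exists>s\<in>feasible cbar. objective_known V f s = Vbar) \<and>
         (\<forall>S\<in>allowable M c. AE \<omega> in M.
            (\<forall>i. convergent (time_avg (shortfall (q i \<omega>) (\<lambda>t. S i t \<omega>) (\<lambda>t. F i t \<omega>)))) \<and>
            Vbar \<le> dissatisfaction V q F S \<omega>) \<and>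
         (\<forall>\<Delta>\<ge>0. \<forall>s\<in>feasible cbar. objective_known V f s \<le> Vbar + \<Delta> \<longrightarrow>
            simple_policy c cbar s \<in> allowable M c \<and>
            (\<forall>S\<in>allowable M c. AE \<omega> in M.
               dissatisfaction V q F (simple_policy c cbar s) \<omega> \<le> dissatisfaction V q F S \<omega> + \<Delta>)))) \<and>
     (\<forall>(f :: 'u \<Rightarrow> 'a \<Rightarrow> real) (p :: 'u \<Rightarrow> real measure).
       (\<forall>i. f i \<in> borel_measurable M) \<and>
       (\<forall>i. distr M borel (f i) = p i) \<and>
       (\<forall>i. AE \<omega> in M. time_avg (\<lambda>t. F i t \<omega>) \<longlonglongrightarrow> f i \<omega>) \<longrightarrow>
       (let Vtilde = (INF s\<in>feasible cbar. objective_unknown V p s) in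
         (\<exists>s\<in>feasible cbar. objective_unknown V p s = Vtilde) \<and>
         (\<forall>S\<in>allowable_unknown M c f.
            (AE \<omega> in M. \<forall>i. convergent (time_avg (shortfall (q i \<omega>) (\<lambda>t. S i t \<omega>) (\<lambda>t. F i t \<omega>)))) \<and>
            Vtilde \<le> expected_dissatisfaction M V q F S) \<and>
         (\<forall>\<Delta>\<ge>0. \<forall>s\<in>feasible cbar. objective_unknown V p s \<le> Vtilde + ennreal \<Delta> \<longrightarrow>
            simple_policy c cbar s \<in> allowable_unknown M c f \<and>
            (\<forall>S\<in>allowable_unknown M c f.
               expected_dissatisfaction M V q F (simple_policy c cbar s)
                 \<le> expected_dissatisfaction M V q F S + ennreal \<Delta>))))"
proof (intro conjI allI impI)
  fix f :: "'u \<Rightarrow> real"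
  assume F_avg: "\<forall>i. AE \<omega> in M. time_avg (\<lambda>t. F i t \<omega>) \<longlonglongrightarrow> f i"
  define v where "v = (INF s\<in>feasible cbar. objective_known V f s)"
  obtain s0 where s0: "s0 \<in> feasible cbar"
    and s0_min: "\<And>s'. s' \<in> feasible cbar \<Longrightarrow> objective_known V f s0 \<le> objective_known V f s'"
    using known_cost_minimizer[where V = V and cbar = cbar and f = f, OF V_mono V_concave V_nonneg V_zero] cbar_pos by auto
  have v: "v = objective_known V f s0"
    unfolding v_def using s0 s0_min by (intro cInf_eq_minimum) auto
  have diss_eq: "AE \<omega> in M. dissatisfaction V q F S \<omega> = objective_known V f (\<lambda>i. lim_avg (\<lambda>t. S i t \<omega>))"
    if "S \<in> allowable M c" for S
    using dissatisfaction_eq_objective[OF that c_avg] F_avg by blast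
  have lower: "AE \<omega> in M. v \<le> dissatisfaction V q F S \<omega>" if S: "S \<in> allowable M c" for S
    using diss_eq[OF S] allowable_averages[OF S c_avg]
    by eventually_elim (simp add: v s0_min)
  show "let Vbar = (INF s\<in>feasible cbar. objective_known V f s) in
         (\<exists>s\<in>feasible cbar. objective_known V f s = Vbar) \<and>
         (\<forall>S\<in>allowable M c. AE \<omega> in M.
            (\<forall>i. convergent (time_avg (shortfall (q i \<omega>) (\<lambda>t. S i t \<omega>) (\<lambda>t. F i t \<omega>)))) \<and>
            Vbar \<le> dissatisfaction V q F S \<omega>) \<and>
         (\<forall>\<Delta>\<ge>0. \<forall>s\<in>feasible cbar. objective_known V f s \<le> Vbar + \<Delta> \<longrightarrow>
            simple_policy c cbar s \<in> allowable M c \<and>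
            (\<forall>S\<in>allowable M c. AE \<omega> in M.
               dissatisfaction V q F (simple_policy c cbar s) \<omega> \<le> dissatisfaction V q F S \<omega> + \<Delta>))"
    unfolding Let_def v_def[symmetric]
  proof (intro conjI ballI allI impI)
    show "\<exists>s\<in>feasible cbar. objective_known V f s = v" using s0 v by blast
  next
    fix S :: "'u \<Rightarrow> nat \<Rightarrow> 'a \<Rightarrow> real" assume S: "S \<in> allowable M c"
    from allowable_shortfall[OF S c_avg, of F "\<lambda>i \<omega>. f i" q] F_avg
    have "AE \<omega> in M. \<forall>i. time_avg (shortfall (q i \<omega>) (\<lambda>t. S i t \<omega>) (\<lambda>t. F i t \<omega>))
        \<longlonglongrightarrow> max (f i - lim_avg (\<lambda>t. S i t \<omega>)) 0" by blast
    with lower[OF S]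
    show "AE \<omega> in M. (\<forall>i. convergent (time_avg (shortfall (q i \<omega>) (\<lambda>t. S i t \<omega>) (\<lambda>t. F i t \<omega>)))) \<and>
            v \<le> dissatisfaction V q F S \<omega>"
      by eventually_elim (auto intro: convergentI)
  next
    fix \<Delta> :: real and s assume s: "s \<in> feasible cbar" and gap: "objective_known V f s \<le> v + \<Delta>"
    show simple: "simple_policy c cbar s \<in> allowable M c"
      by (rule simple_policy_allowable[OF c_meas c_nonneg c_avg cbar_pos s])
    have avg: "AE \<omega> in M. \<forall>i. lim_avg (\<lambda>t. simple_policy c cbar s i t \<omega>) = s i"
      by (intro eventually_all_finite simple_policy_lim_avg[OF c_avg cbar_pos])
    fix S :: "'u \<Rightarrow> nat \<Rightarrow> 'a \<Rightarrow> real" assume S: "S \<in> allowable M c"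
    show "AE \<omega> in M. dissatisfaction V q F (simple_policy c cbar s) \<omega>
        \<le> dissatisfaction V q F S \<omega> + \<Delta>"
      using diss_eq[OF simple] avg lower[OF S]
    proof eventually_elim
      case (elim \<omega>)
      then show ?case using gap by simp
    qed
  qed
next
  fix f :: "'u \<Rightarrow> 'a \<Rightarrow> real" and p :: "'u \<Rightarrow> real measure"
  assume asm: "(\<forall>i. f i \<in> borel_measurable M) \<and> (\<forall>i. distr M borel (f i) = p i) \<and>
       (\<forall>i. AE \<omega> in M. time_avg (\<lambda>t. F i t \<omega>) \<longlonglongrightarrow> f i \<omega>)"
  then have f_meas: "\<And>i. f i \<in> borel_measurable M" and p: "p = (\<lambda>i. distr M borel (f i))"
    and F_avg: "\<And>i. AE \<omega> in M. time_avg (\<lambda>t. F i t \<omega>) \<longlonglongrightarrow> f i \<omega>"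
    by auto
  interpret prob_space M by fact
  define v where "v = (INF s\<in>feasible cbar. objective_unknown V p s)"
  obtain s0 where s0: "s0 \<in> feasible cbar"
    and s0_min: "\<And>s'. s' \<in> feasible cbar \<Longrightarrow> objective_unknown V p s0 \<le> objective_unknown V p s'"
    using expected_cost_minimizer[where V = V and p = p and cbar = cbar, OF V_mono V_concave V_zero] cbar_pos
    by (auto simp: p)
  have v: "v = objective_unknown V p s0"
    unfolding v_def using s0 s0_min by (intro antisym INF_lower INF_greatest)
  have diss_eq: "expected_dissatisfaction M V q F S
      = (\<integral>\<^sup>+\<omega>. objective_unknown V p (\<lambda>i. lim_avg (\<lambda>t. S i t \<omega>)) \<partial>M)"
    if "S \<in> allowable_unknown M c f" for S
    unfolding p by (rule expected_dissatisfaction_eq_objective[OF \<open>prob_space M\<close> that c_avg F_avg V_mono])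
  have lower: "v \<le> expected_dissatisfaction M V q F S" if S: "S \<in> allowable_unknown M c f" for S
  proof -
    have S': "S \<in> allowable M c" using S by (simp add: allowable_unknown_def)
    have "v = (\<integral>\<^sup>+\<omega>. v \<partial>M)" by (simp add: emeasure_space_1)
    also have "\<dots> \<le> (\<integral>\<^sup>+\<omega>. objective_unknown V p (\<lambda>i. lim_avg (\<lambda>t. S i t \<omega>)) \<partial>M)"
    proof (rule nn_integral_mono_AE)
      show "AE \<omega> in M. v \<le> objective_unknown V p (\<lambda>i. lim_avg (\<lambda>t. S i t \<omega>))"
        using allowable_averages[OF S' c_avg] by eventually_elim (simp add: v s0_min)
    qed
    finally show ?thesis by (simp add: diss_eq[OF S])
  qed
  show "let Vtilde = (INF s\<in>feasible cbar. objective_unknown V p s) in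
         (\<exists>s\<in>feasible cbar. objective_unknown V p s = Vtilde) \<and>
         (\<forall>S\<in>allowable_unknown M c f.
            (AE \<omega> in M. \<forall>i. convergent (time_avg (shortfall (q i \<omega>) (\<lambda>t. S i t \<omega>) (\<lambda>t. F i t \<omega>)))) \<and>
            Vtilde \<le> expected_dissatisfaction M V q F S) \<and>
         (\<forall>\<Delta>\<ge>0. \<forall>s\<in>feasible cbar. objective_unknown V p s \<le> Vtilde + ennreal \<Delta> \<longrightarrow>
            simple_policy c cbar s \<in> allowable_unknown M c f \<and>
            (\<forall>S\<in>allowable_unknown M c f.
               expected_dissatisfaction M V q F (simple_policy c cbar s)
                 \<le> expected_dissatisfaction M V q F S + ennreal \<Delta>))"
    unfolding Let_def v_def[symmetric]
  proof (intro conjI ballI allI impI)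
    show "\<exists>s\<in>feasible cbar. objective_unknown V p s = v" using s0 v by blast
  next
    fix S :: "'u \<Rightarrow> nat \<Rightarrow> 'a \<Rightarrow> real" assume "S \<in> allowable_unknown M c f"
    then have S: "S \<in> allowable M c" by (simp add: allowable_unknown_def)
    show "AE \<omega> in M. \<forall>i. convergent (time_avg (shortfall (q i \<omega>) (\<lambda>t. S i t \<omega>) (\<lambda>t. F i t \<omega>)))"
      using allowable_shortfall[OF S c_avg F_avg, of q]
      by eventually_elim (auto intro: convergentI)
  next
    fix S :: "'u \<Rightarrow> nat \<Rightarrow> 'a \<Rightarrow> real" assume "S \<in> allowable_unknown M c f"
    then show "v \<le> expected_dissatisfaction M V q F S" by (rule lower)
  next
    fix \<Delta> :: real and s
    assume s: "s \<in> feasible cbar" and gap: "objective_unknown V p s \<le> v + ennreal \<Delta>"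
    show simple: "simple_policy c cbar s \<in> allowable_unknown M c f"
      by (rule simple_policy_allowable_unknown[OF \<open>prob_space M\<close> c_meas c_nonneg c_avg cbar_pos s f_meas])
    have avg: "AE \<omega> in M. \<forall>i. lim_avg (\<lambda>t. simple_policy c cbar s i t \<omega>) = s i"
      by (intro eventually_all_finite simple_policy_lim_avg[OF c_avg cbar_pos])
    have "expected_dissatisfaction M V q F (simple_policy c cbar s) = (\<integral>\<^sup>+\<omega>. objective_unknown V p s \<partial>M)"
      unfolding diss_eq[OF simple]
    proof (rule nn_integral_cong_AE)
      show "AE \<omega> in M. objective_unknown V p (\<lambda>i. lim_avg (\<lambda>t. simple_policy c cbar s i t \<omega>))
          = objective_unknown V p s"
        using avg by eventually_elim simp
    qed
    then have "expected_dissatisfaction M V q F (simple_policy c cbar s) \<le> v + ennreal \<Delta>"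
      using gap by (simp add: emeasure_space_1)
    moreover fix S :: "'u \<Rightarrow> nat \<Rightarrow> 'a \<Rightarrow> real" assume "S \<in> allowable_unknown M c f"
    ultimately show "expected_dissatisfaction M V q F (simple_policy c cbar s)
        \<le> expected_dissatisfaction M V q F S + ennreal \<Delta>"
      using add_right_mono[OF lower] order_trans by blast
  qed
qed

end
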